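(* Let $k\in\{0,1,2,\dots\}$, $l\in\{1,2,\dots\}$ and $t>0$. Then $$\frac{1}{k!}\sum_{r_1,\dots,r_l,s_1,\dots,s_k\ge0}\frac{(s_1+\dots+s_k+r_1+2r_2+\dots+lr_l+kl+k+l)!}{(s_1+l+1)\cdots(s_k+l+1)\,1^{r_1}2^{r_2}\cdots l^{r_l}\,r_1!\cdots r_l!}\cdot\frac{t^{k+r_1+\dots+r_l+1}}{(t)_{s_1+\dots+s_k+r_1+2r_2+\dots+lr_l+kl+k+l+1}}=1,$$ the sum being over nonnegative integers.
   Context: $(x)_n=x(x+1)\cdots(x+n-1)$ denotes the Pochhammer symbol. *)

theory Defs
  imports "HOL-Analysis.Infinite_Sum" "HOL-Library.FuncSet"
begin

text \<open>
  A tuple of natural numbers indexed by \<open>1, \<dots>, n\<close> is an extensional function on \<open>{1..n}\<close>,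
  so that distinct functions are distinct tuples; for \<open>n = 0\<close> there is exactly one tuple.
\<close>

definition nat_tuples :: "nat \<Rightarrow> (nat \<Rightarrow> nat) set" where
  "nat_tuples n = {1..n} \<rightarrow>\<^sub>E (UNIV :: nat set)"

definition index_weight :: "nat \<Rightarrow> nat \<Rightarrow> (nat \<Rightarrow> nat) \<Rightarrow> (nat \<Rightarrow> nat) \<Rightarrow> nat" where
  "index_weight k l r s = (\<Sum>j=1..k. s j) + (\<Sum>i=1..l. i * r i) + k * l + k + l"

definition summand :: "nat \<Rightarrow> nat \<Rightarrow> real \<Rightarrow> (nat \<Rightarrow> nat) \<Rightarrow> (nat \<Rightarrow> nat) \<Rightarrow> real" where
  "summand k l t r s =
     fact (index_weight k l r s)
       / ((\<Prod>j=1..k. real (s j + l + 1)) * (\<Prod>i=1..l. real i ^ r i) * (\<Prod>i=1..l. fact (r i)))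
     * (t ^ (k + (\<Sum>i=1..l. r i) + 1) / pochhammer t (index_weight k l r s + 1))"

end

theory Submission
  imports Defs "HOL-Analysis.Analysis" "HOL-Real_Asymp.Real_Asymp"
begin

text \<open>
  Writing \<open>N! / (t)\<^bsub>N+1\<^esub>\<close> as the Beta integral of \<open>x^N (1 - x) powr (t - 1)\<close> over \<open>(0, 1)\<close>, the sum and
  the integral may be interchanged since all terms are nonnegative. The inner sum then factors:
  the \<open>r\<^sub>i\<close> contribute exponential series and the \<open>s\<^sub>j\<close> contribute copies of the tail \<open>T\<close> of the series
  of \<open>- ln (1 - x)\<close> beyond degree \<open>l\<close>. The exponentials combine with the power of \<open>1 - x\<close> to
  \<open>exp (- t T) / (1 - x)\<close>, and \<open>T' = x^l / (1 - x)\<close>, so \<open>u = t T\<close> turns the integral into the one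
  of \<open>exp (- u) u^k\<close> over \<open>(0, \<infinity>)\<close>, which is \<open>k!\<close>.
\<close>

text \<open>For nonnegative terms, a finite integral over counting measure is already absolute
  summability. The whole computation can thus run in \<open>ennreal\<close>, and convergence of the
  sum comes out together with its value.\<close>

lemma has_sum_count_space_nn_integral:
  fixes f :: "'a \<Rightarrow> real"
  assumes nonneg: "\<And>x. x \<in> A \<Longrightarrow> f x \<ge> 0" and "S \<ge> 0"
    and eq: "(\<integral>\<^sup>+x. ennreal (f x) \<partial>count_space A) = ennreal S"
  shows "(f has_sum S) A"
proof -
  have abs: "Infinite_Set_Sum.abs_summable_on f A"
    unfolding Infinite_Set_Sum.abs_summable_on_def
    by (rule integrableI_nn_integral_finite[OF _ _ eq]) (use nonneg in \<open>auto simp: AE_count_space\<close>)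
  have "ennreal (infsetsum f A) = ennreal S"
    using nn_integral_conv_infsetsum[OF abs nonneg] eq by simp
  moreover have "infsetsum f A \<ge> 0"
    using nonneg by (rule infsetsum_nonneg)
  ultimately have "infsetsum f A = S"
    using \<open>S \<ge> 0\<close> by simp
  moreover have "f summable_on A"
    using abs by (simp add: abs_summable_equivalent[symmetric] abs_summable_summable)
  ultimately show ?thesis
    using infsetsum_infsum[OF abs] by (simp add: has_sum_iff)
qed

lemma sums_nonneg_infsetsum:
  fixes f :: "nat \<Rightarrow> real"
  assumes "f sums S" "\<And>n. f n \<ge> 0"
  shows "Infinite_Set_Sum.abs_summable_on f UNIV" "infsetsum f UNIV = S"
proof -
  show *: "Infinite_Set_Sum.abs_summable_on f UNIV"
    using assms by (simp add: abs_summable_on_nat_iff' sums_iff)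
  show "infsetsum f UNIV = S"
    using infsetsum_nat'[OF *] assms(1) by (simp add: sums_iff)
qed

definition log_tail :: "nat \<Rightarrow> real \<Rightarrow> real" where
  "log_tail l x = - ln (1 - x) - (\<Sum>i=1..l. x ^ i / real i)"

lemma log_tail_sums:
  assumes "\<bar>x\<bar> < 1"
  shows "(\<lambda>s. x ^ (s + l + 1) / real (s + l + 1)) sums log_tail l x"
proof -
  have "(\<lambda>n. x ^ n / real n) sums (- ln (1 - x))"
    using sums_minus[OF ln_series'[of "-x"]] assms by simp
  from sums_split_initial_segment[OF this, of "Suc l"]
  have "(\<lambda>s. x ^ (s + Suc l) / real (s + Suc l)) sums
      (- ln (1 - x) - (\<Sum>i<Suc l. x ^ i / real i))" .
  \<comment> \<open>The extra term at \<open>i = 0\<close> is a division by zero, hence 0.\<close>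
  also have "(\<Sum>i<Suc l. x ^ i / real i) = (\<Sum>i=1..l. x ^ i / real i)"
    by (intro sum.mono_neutral_right) (auto simp: Suc_le_eq)
  finally show ?thesis
    by (simp add: log_tail_def)
qed

lemma log_tail_nonneg:
  assumes "0 \<le> x" "x < 1"
  shows "log_tail l x \<ge> 0"
  using sums_le[OF _ sums_zero log_tail_sums, of x l] assms by auto

lemma log_tail_0 [simp]: "log_tail l 0 = 0"
  by (auto simp: log_tail_def intro!: sum.neutral)

text \<open>Differentiating the closed form turns the subtracted polynomial into a finite geometric
  sum, which cancels all of \<open>1 / (1 - x)\<close> except
  \<open>x ^ l / (1 - x)\<close>.\<close>

lemma DERIV_log_tail:
  assumes "x < 1"
  shows "(log_tail l has_real_derivative x ^ l / (1 - x)) (at x)"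
proof -
  have "(log_tail l has_real_derivative (1 / (1 - x) - (\<Sum>i=1..l. x ^ (i - 1)))) (at x)"
    unfolding log_tail_def using assms
    by (auto intro!: derivative_eq_intros sum.cong simp: divide_simps)
  also have "(\<Sum>i=1..l. x ^ (i - 1)) = (\<Sum>i<l. x ^ i)"
    by (rule sum.reindex_bij_witness[of _ Suc "\<lambda>i. i - 1"]) auto
  also have "\<dots> = (1 - x ^ l) / (1 - x)"
    using assms by (simp add: sum_gp_strict)
  also have "1 / (1 - x) - (1 - x ^ l) / (1 - x) = x ^ l / (1 - x)"
    by (simp add: diff_divide_distrib)
  finally show ?thesis .
qed

text \<open>The logarithm blows up at 1 while the polynomial stays bounded. This supplies the upper
  limit infinity for the substituted variable \<open>u\<close>.\<close>

lemma filterlim_log_tail: "filterlim (log_tail l) at_top (at_left 1)"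
proof -
  have "filterlim (\<lambda>x::real. - ln (1 - x)) at_top (at_left 1)"
    by real_asymp
  moreover have "((\<lambda>x::real. - (\<Sum>i=1..l. x ^ i / real i)) \<longlongrightarrow> - (\<Sum>i=1..l. 1 ^ i / real i)) (at_left 1)"
    by (intro tendsto_intros) auto
  moreover have "log_tail l = (\<lambda>x. - (\<Sum>i=1..l. x ^ i / real i) + - ln (1 - x))"
    by (simp add: log_tail_def fun_eq_iff)
  ultimately show ?thesis
    by (simp only: filterlim_tendsto_add_at_top)
qed

text \<open>Each induction step is one integration by parts. The antiderivative is a truncated
  exponential series times \<open>- fact k * exp (- u)\<close>, with value \<open>- fact k\<close>
  at 0 and limit 0 at infinity.\<close>

lemma DERIV_gamma_antiderivative:
  "((\<lambda>u::real. - exp (- u) * (\<Sum>j\<le>k. fact k / fact j * u ^ j)) has_real_derivative exp (- u) * u ^ k) (at u)"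
proof (induction k)
  case 0
  show ?case
    by (auto intro!: derivative_eq_intros)
next
  case (Suc k)
  have split: "(\<Sum>j\<le>Suc k. fact (Suc k) / fact j * u ^ j)
      = real (Suc k) * (\<Sum>j\<le>k. fact k / fact j * u ^ j) + u ^ Suc k" for u :: real
    by (simp add: sum_distrib_left mult_ac)
  have "((\<lambda>u::real. exp (- u) * u ^ Suc k) has_real_derivative
      real (Suc k) * (exp (- u) * u ^ k) - exp (- u) * u ^ Suc k) (at u)"
    by (rule derivative_eq_intros refl)+ (simp add: algebra_simps)
  from DERIV_diff[OF DERIV_cmult[OF Suc.IH, of "real (Suc k)"] this]
  have "((\<lambda>u::real. real (Suc k) * (- exp (- u) * (\<Sum>j\<le>k. fact k / fact j * u ^ j)) - exp (- u) * u ^ Suc k)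
      has_real_derivative exp (- u) * u ^ Suc k) (at u)"
    by (simp only: diff_diff_eq2 add_diff_cancel_left')
  also have "(\<lambda>u::real. real (Suc k) * (- exp (- u) * (\<Sum>j\<le>k. fact k / fact j * u ^ j)) - exp (- u) * u ^ Suc k)
      = (\<lambda>u. - exp (- u) * (\<Sum>j\<le>Suc k. fact (Suc k) / fact j * u ^ j))"
    unfolding split by (simp only: distrib_left mult_minus_left mult_minus_right mult.left_commute diff_conv_add_uminus)
  finally show ?case .
qed

text \<open>The substitution \<open>u = t * log_tail l x\<close> is carried out by composing the
  gamma antiderivative with it and applying the fundamental theorem of calculus.\<close>

lemma has_integral_gamma_log_tail:
  fixes t :: real
  assumes "t > 0"
  shows "((\<lambda>x. exp (- (t * log_tail l x)) * (t * log_tail l x) ^ k * (t * (x ^ l / (1 - x))))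
    has_integral fact k) {0<..<1}"
proof -
  define G where "G u = - exp (- u) * (\<Sum>j\<le>k. fact k / fact j * u ^ j)" for u :: real
  \<comment> \<open>At 1 the value of \<open>log_tail\<close> rests on \<open>ln 0\<close> and
    carries no meaning. Putting the limit 0 there makes \<open>F\<close> continuous on the closed
    interval.\<close>
  define F where "F x = (if x = 1 then 0 else G (t * log_tail l x))" for x
  define f where "f x = exp (- (t * log_tail l x)) * (t * log_tail l x) ^ k * (t * (x ^ l / (1 - x)))" for x
  have D: "((\<lambda>x. G (t * log_tail l x)) has_real_derivative f x) (at x)" if "x < 1" for x
    unfolding f_def G_def
    by (rule DERIV_chain2[OF DERIV_gamma_antiderivative])
      (intro DERIV_cmult DERIV_log_tail that)
  have DF: "(F has_real_derivative f x) (at x)" if "x < 1" for x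
    using D[OF that]
  proof (rule DERIV_cong_ev[THEN iffD1, OF refl _ refl, rotated])
    show "\<forall>\<^sub>F y in nhds x. G (t * log_tail l y) = F y"
      by (rule eventually_mono[OF eventually_nhds_in_open[of "{..<1}" x]])
        (use that in \<open>auto simp: F_def\<close>)
  qed
  have "(G \<longlongrightarrow> - (\<Sum>j\<le>k. fact k / fact j * 0)) at_top"
  proof -
    have "((\<lambda>u::real. - (\<Sum>j\<le>k. fact k / fact j * (u ^ j / exp u)))
        \<longlongrightarrow> - (\<Sum>j\<le>k. fact k / fact j * 0)) at_top"
      by (intro tendsto_minus tendsto_sum tendsto_mult tendsto_const tendsto_power_div_exp_0)
    then show ?thesis
      unfolding G_def by (simp add: sum_distrib_left exp_minus field_simps sum_negf)
  qed
  then have "((\<lambda>x. G (t * log_tail l x)) \<longlongrightarrow> 0) (at_left 1)"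
    using filterlim_compose[OF _ filterlim_tendsto_pos_mult_at_top[OF tendsto_const \<open>t > 0\<close> filterlim_log_tail]]
    by auto
  then have "(F \<longlongrightarrow> 0) (at_left 1)"
    by (rule Lim_transform_eventually) (auto simp: F_def eventually_at_filter)
  then have "(F \<longlongrightarrow> F 1) (at_left 1)"
    by (simp add: F_def)
  then have "continuous (at 1 within {0..1}) F"
    by (simp add: continuous_within at_within_Icc_at_left)
  moreover have "continuous (at x within {0..1}) F" if "x < 1" for x
    using DF[OF that] by (meson DERIV_isCont continuous_at_imp_continuous_at_within)
  ultimately have "continuous_on {0..1} F"
    unfolding continuous_on_eq_continuous_within by (metis atLeastAtMost_iff less_eq_real_def)
  then have "(f has_integral (F 1 - F 0)) {0..1}"
    by (intro fundamental_theorem_of_calculus_interior)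
      (auto simp: has_real_derivative_iff_has_vector_derivative[symmetric] intro: DF)
  \<comment> \<open>At \<open>u = 0\<close> only the summand \<open>j = 0\<close> survives, so
    \<open>F 0 = - fact k\<close>.\<close>
  moreover have "F 1 - F 0 = fact k"
    by (simp add: F_def G_def sum.atMost_shift)
  ultimately show ?thesis
    by (simp only: f_def[abs_def] has_integral_Icc_iff_Ioo)
qed

text \<open>In \<open>Beta (n + 1) t\<close>, the factor \<open>Gamma (n + 1)\<close> is
  \<open>fact n\<close>, and \<open>Gamma t / Gamma (t + n + 1)\<close> is the reciprocal of the
  Pochhammer symbol.\<close>

lemma has_integral_Beta_pochhammer:
  fixes t :: real
  assumes "t > 0"
  shows "((\<lambda>x. x ^ n * (1 - x) powr (t - 1)) has_integral fact n / pochhammer t (n + 1)) {0<..<1}"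
proof -
  have "((\<lambda>x. x powr (real (n + 1) - 1) * (1 - x) powr (t - 1)) has_integral Beta (real (n + 1)) t) {0<..<1}"
    using has_integral_Beta_real[of "real (n + 1)" t] assms by (simp add: has_integral_Icc_iff_Ioo)
  moreover have "Beta (real (n + 1)) t = fact n / pochhammer t (n + 1)"
  proof -
    have "t \<notin> \<int>\<^sub>\<le>\<^sub>0"
      using assms by (auto elim!: nonpos_Ints_cases)
    then show ?thesis
      using Gamma_fact[of n, where ?'a = real] pochhammer_Gamma[of t "n + 1"]
      by (simp add: Beta_def add_ac)
  qed
  \<comment> \<open>The open interval matters: at \<open>x = 0\<close> and \<open>n = 0\<close> the
    two powers differ, since \<open>0 powr 0 = 0\<close>.\<close>
  moreover have "x powr (real (n + 1) - 1) = x ^ n" if "x \<in> {0<..<1}" for x :: real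
    using that by (simp add: powr_realpow)
  ultimately show ?thesis
    by (metis (no_types, lifting) has_integral_cong)
qed

lemma countable_nat_tuples [simp]: "countable (nat_tuples n)"
  by (simp add: nat_tuples_def countable_PiE)

text \<open>Absolute convergence in each coordinate lets a finite product of series be expanded over
  tuples.\<close>

lemma infsetsum_prod_nat_tuples:
  fixes f :: "nat \<Rightarrow> nat \<Rightarrow> real"
  assumes "\<And>i. i \<in> {1..n} \<Longrightarrow> f i sums S i" and "\<And>i m. i \<in> {1..n} \<Longrightarrow> f i m \<ge> 0"
  shows "Infinite_Set_Sum.abs_summable_on (\<lambda>g. \<Prod>i=1..n. f i (g i)) (nat_tuples n)"
    and "infsetsum (\<lambda>g. \<Prod>i=1..n. f i (g i)) (nat_tuples n) = (\<Prod>i=1..n. S i)"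
proof -
  note * = sums_nonneg_infsetsum[OF assms]
  show "Infinite_Set_Sum.abs_summable_on (\<lambda>g. \<Prod>i=1..n. f i (g i)) (nat_tuples n)"
    unfolding nat_tuples_def by (intro abs_summable_on_prod_PiE * finite_atLeastAtMost countableI_type)
  show "infsetsum (\<lambda>g. \<Prod>i=1..n. f i (g i)) (nat_tuples n) = (\<Prod>i=1..n. S i)"
    unfolding nat_tuples_def
    by (subst infsetsum_prod_PiE) (auto intro!: * prod.cong)
qed

text \<open>The summand with its quotient of factorial and Pochhammer symbol replaced by the Beta
  integrand.\<close>

definition monomial :: "nat \<Rightarrow> nat \<Rightarrow> real \<Rightarrow> (nat \<Rightarrow> nat) \<Rightarrow> (nat \<Rightarrow> nat) \<Rightarrow> real \<Rightarrow> real" where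
  "monomial k l t r s x =
     t ^ (k + (\<Sum>i=1..l. r i) + 1)
       / ((\<Prod>j=1..k. real (s j + l + 1)) * (\<Prod>i=1..l. real i ^ r i) * (\<Prod>i=1..l. fact (r i)))
     * (x ^ index_weight k l r s * (1 - x) powr (t - 1))"

lemma monomial_nonneg: "t \<ge> 0 \<Longrightarrow> x \<ge> 0 \<Longrightarrow> monomial k l t r s x \<ge> 0"
  unfolding monomial_def by (intro mult_nonneg_nonneg divide_nonneg_nonneg prod_nonneg) auto

text \<open>The exponent of \<open>x\<close> is distributed as \<open>i\<close> per unit of
  \<open>r i\<close> and \<open>s j + l + 1\<close> per index \<open>j\<close>, which leaves
  \<open>x ^ l\<close>. Each unit of \<open>r i\<close> also takes one factor \<open>t\<close>,
  which leaves \<open>t ^ (k + 1)\<close>.\<close>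

lemma monomial_factor:
  "monomial k l t r s x = t ^ (k + 1) * x ^ l * (1 - x) powr (t - 1) *
     ((\<Prod>i=1..l. (t * (x ^ i / real i)) ^ r i / fact (r i)) *
      (\<Prod>j=1..k. x ^ (s j + l + 1) / real (s j + l + 1)))"
  by (simp add: monomial_def index_weight_def prod_dividef prod.distrib power_mult_distrib power_divide
      power_add power_sum sum.distrib mult_ac add_ac flip: power_mult)

lemma has_integral_monomial:
  assumes "t > 0"
  shows "(monomial k l t r s has_integral summand k l t r s) {0<..<1}"
  using has_integral_mult_right[OF has_integral_Beta_pochhammer[OF assms, of "index_weight k l r s"],
      of "t ^ (k + (\<Sum>i=1..l. r i) + 1)
       / ((\<Prod>j=1..k. real (s j + l + 1)) * (\<Prod>i=1..l. real i ^ r i) * (\<Prod>i=1..l. fact (r i)))"]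
  by (simp add: monomial_def[abs_def] summand_def mult_ac)

text \<open>At fixed \<open>x\<close> the double sum is a product of \<open>l\<close> exponential
  series and \<open>k\<close> copies of the logarithm tail. The result is the gamma integrand in
  \<open>u = t * log_tail l x\<close>, times the derivative of \<open>u\<close>.\<close>

lemma nn_integral_count_space_monomial:
  assumes "t > 0" and x: "0 < x" "x < 1"
  shows "(\<integral>\<^sup>+p. ennreal (case p of (r, s) \<Rightarrow> monomial k l t r s x) \<partial>count_space (nat_tuples l \<times> nat_tuples k))
    = ennreal (exp (- (t * log_tail l x)) * (t * log_tail l x) ^ k * (t * (x ^ l / (1 - x))))"
proof -
  let ?R = "\<lambda>r. \<Prod>i=1..l. (t * (x ^ i / real i)) ^ r i / fact (r i)"
  let ?S = "\<lambda>s. \<Prod>j=1..k. x ^ (s j + l + 1) / real (s j + l + 1)"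
  let ?c = "t ^ (k + 1) * x ^ l * (1 - x) powr (t - 1)"
  have e: "(\<lambda>m. (t * (x ^ i / real i)) ^ m / fact m) sums exp (t * (x ^ i / real i))" for i
    using exp_converges[of "t * (x ^ i / real i)"] by (simp add: field_simps)
  have R: "Infinite_Set_Sum.abs_summable_on ?R (nat_tuples l)"
      "infsetsum ?R (nat_tuples l) = (\<Prod>i=1..l. exp (t * (x ^ i / real i)))"
    using assms by (intro infsetsum_prod_nat_tuples[where f = "\<lambda>i m. (t * (x ^ i / real i)) ^ m / fact m"
          and S = "\<lambda>i. exp (t * (x ^ i / real i))"] e; simp)+
  have S: "Infinite_Set_Sum.abs_summable_on ?S (nat_tuples k)"
      "infsetsum ?S (nat_tuples k) = (\<Prod>j=1..k. log_tail l x)"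
    using assms by (intro infsetsum_prod_nat_tuples[where f = "\<lambda>j m. x ^ (m + l + 1) / real (m + l + 1)"
          and S = "\<lambda>_. log_tail l x"] log_tail_sums; simp)+
  have eq: "(\<lambda>(r, s). monomial k l t r s x) = (\<lambda>p. ?c * (case p of (r, s) \<Rightarrow> ?R r * ?S s))"
    by (simp add: monomial_factor fun_eq_iff)
  note abs = abs_summable_on_product[OF countable_nat_tuples countable_nat_tuples R(1) S(1)]
  have "Infinite_Set_Sum.abs_summable_on (\<lambda>(r, s). monomial k l t r s x) (nat_tuples l \<times> nat_tuples k)"
    unfolding eq by (rule abs_summable_on_cmult_right) (rule abs)
  then have "(\<integral>\<^sup>+p. ennreal (case p of (r, s) \<Rightarrow> monomial k l t r s x) \<partial>count_space (nat_tuples l \<times> nat_tuples k))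
    = ennreal (infsetsum (\<lambda>(r, s). monomial k l t r s x) (nat_tuples l \<times> nat_tuples k))"
    using assms by (intro nn_integral_conv_infsetsum) (auto simp: monomial_nonneg)
  also have "infsetsum (\<lambda>(r, s). monomial k l t r s x) (nat_tuples l \<times> nat_tuples k)
      = ?c * ((\<Prod>i=1..l. exp (t * (x ^ i / real i))) * log_tail l x ^ k)"
    unfolding eq using abs infsetsum_product[OF _ _ R(1) S(1)] R(2) S(2)
    by (subst infsetsum_cmult_right) auto
  also have "(\<Prod>i=1..l. exp (t * (x ^ i / real i))) = exp (t * (\<Sum>i=1..l. x ^ i / real i))"
    by (simp add: exp_sum sum_distrib_left)
  also have "(1 - x) powr (t - 1) = exp (t * ln (1 - x)) / (1 - x)"
    using x by (simp add: powr_def algebra_simps exp_diff)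
  \<comment> \<open>Of the \<open>k + 1\<close> factors \<open>t\<close>, \<open>k\<close> join the
    powers of \<open>log_tail\<close> and one belongs to the derivative of \<open>u\<close>.\<close>
  also have "t ^ (k + 1) * x ^ l * (exp (t * ln (1 - x)) / (1 - x)) *
        (exp (t * (\<Sum>i=1..l. x ^ i / real i)) * log_tail l x ^ k)
      = (exp (t * ln (1 - x)) * exp (t * (\<Sum>i=1..l. x ^ i / real i)))
        * (t * log_tail l x) ^ k * (t * (x ^ l / (1 - x)))"
    by (simp add: power_mult_distrib mult_ac)
  also have "exp (t * ln (1 - x)) * exp (t * (\<Sum>i=1..l. x ^ i / real i)) = exp (- (t * log_tail l x))"
    unfolding log_tail_def exp_add[symmetric] by (simp add: algebra_simps)
  finally show ?thesis .
qed

lemma has_sum_summand: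
  fixes t :: real
  assumes "t > 0"
  shows "((\<lambda>(r, s). summand k l t r s) has_sum fact k) (nat_tuples l \<times> nat_tuples k)"
proof (rule has_sum_count_space_nn_integral)
  let ?A = "nat_tuples l \<times> nat_tuples k"
  let ?I = "indicator {0<..<1} :: real \<Rightarrow> ennreal"
  let ?H = "\<lambda>x. exp (- (t * log_tail l x)) * (t * log_tail l x) ^ k * (t * (x ^ l / (1 - x)))"
  let ?M = "\<lambda>p x. case p of (r, s) \<Rightarrow> monomial k l t r s x"
  have "(\<integral>\<^sup>+p. ennreal (case p of (r, s) \<Rightarrow> summand k l t r s) \<partial>count_space ?A)
      = (\<integral>\<^sup>+p. (\<integral>\<^sup>+x. ennreal (?M p x) * ?I x \<partial>lborel) \<partial>count_space ?A)"
    using assms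
    by (intro nn_integral_cong)
      (auto intro!: nn_integral_has_integral_lebesgue'[symmetric] monomial_nonneg has_integral_monomial)
  \<comment> \<open>Sum and integral are exchanged by monotone convergence: the index set is
    countable and each term is nonnegative and measurable in \<open>x\<close>.\<close>
  also have "\<dots> = (\<integral>\<^sup>+x. (\<integral>\<^sup>+p. ennreal (?M p x) * ?I x \<partial>count_space ?A) \<partial>lborel)"
    by (intro nn_integral_count_space_nn_integral[symmetric]) (auto simp: monomial_def[abs_def])
  also have "\<dots> = (\<integral>\<^sup>+x. ennreal (?H x) * ?I x \<partial>lborel)"
    using assms
    by (intro nn_integral_cong)
      (auto simp: nn_integral_multc nn_integral_count_space_monomial split: split_indicator)
  also have "\<dots> = ennreal (fact k)"
    using assms
    by (intro nn_integral_has_integral_lebesgue' has_integral_gamma_log_tail)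
      (auto intro!: mult_nonneg_nonneg divide_nonneg_nonneg zero_le_power log_tail_nonneg)
  finally show "(\<integral>\<^sup>+p. ennreal (case p of (r, s) \<Rightarrow> summand k l t r s) \<partial>count_space ?A) = ennreal (fact k)" .
  have "summand k l t r s \<ge> 0" for r s
    unfolding summand_def using assms pochhammer_pos[of t, THEN less_imp_le]
    by (intro mult_nonneg_nonneg divide_nonneg_nonneg prod_nonneg) auto
  then show "(case p of (r, s) \<Rightarrow> summand k l t r s) \<ge> 0" for p
    by (simp split: prod.split)
qed simp

theorem theorem3p3p2:
  fixes k l :: nat and t :: real
  assumes "l \<ge> 1" and "t > 0"
  shows "(\<lambda>(r, s). summand k l t r s) summable_on (nat_tuples l \<times> nat_tuples k) \<and>
    1 / fact k * (\<Sum>\<^sub>\<infinity>(r, s)\<in>nat_tuples l \<times> nat_tuples k. summand k l t r s) = 1"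
  using has_sum_summand[OF assms(2), where k = k and l = l] by (auto simp: has_sum_iff)

end
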